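(* (i) Every $a=a_0+a_1\mathbf{e}_1+a_2\mathbf{e}_2+a_3\mathbf{e}_3\in S_1$ can be written in the form $$a=a_0+\Im(a)=N_a\Big(\frac{a_0}{N_a}+\frac{\Im(a)}{\sqrt{V_a}}\frac{\sqrt{V_a}}{N_a}\Big)=N_a(\cosh\theta+\varepsilon\sinh\theta),$$ where $\theta\in\mathbb{R}$, $\cosh\theta=\frac{a_0}{N_a}$, $\sinh\theta=\frac{\sqrt{V_a}}{N_a}$, $\varepsilon=\frac{\Im(a)}{\sqrt{V_a}}\in E_1$, and $$a^n=N_a^n(\cosh n\theta+\varepsilon\sinh n\theta)\quad\text{for all } n\in\mathbb{Z}.$$ (ii) Every $a=a_0+a_1\mathbf{e}_1+a_2\mathbf{e}_2+a_3\mathbf{e}_3\in S_2$ can be written in the form $$a=a_0+\Im(a)=N_a\Big(\frac{a_0}{N_a}+\frac{\Im(a)}{\sqrt{-V_a}}\frac{\sqrt{-V_a}}{N_a}\Big)=N_a(\cos\theta+\varepsilon\sin\theta),$$ where $\theta\in\mathbb{R}$, $\cos\theta=\frac{a_0}{N_a}$, $\sin\theta=\frac{\sqrt{-V_a}}{N_a}$, $\varepsilon=\frac{\Im(a)}{\sqrt{-V_a}}\in E_{-1}$, and $$a^n=N_a^n(\cos n\theta+\varepsilon\sin n\theta)\quad\text{for all } n\in\mathbb{Z}.$$ (iii) Every $a=a_0+a_1\mathbf{e}_1+a_2\mathbf{e}_2+a_3\mathbf{e}_3\in S_3$ can be written in the form $$a=a_0+\Im(a)=N_a\Big(\frac{a_0}{N_a}+\frac{\Im(a)}{\sqrt{V_a}}\frac{\sqrt{V_a}}{N_a}\Big)=N_a(\sinh\theta+\varepsilon\cosh\theta),$$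 where $\theta\in\mathbb{R}$, $\sinh\theta=\frac{a_0}{N_a}$, $\cosh\theta=\frac{\sqrt{V_a}}{N_a}$, $\varepsilon=\frac{\Im(a)}{\sqrt{V_a}}\in E_1$, and $$a^n=\begin{cases}(N_a)^{2k+1}\big(\sinh (2k+1)\theta+\varepsilon\cosh (2k+1)\theta\big), & n=2k+1,\ \forall k\in\mathbb{Z};\\ (N_a)^{2k}\big(\cosh 2k\theta+\varepsilon\sinh 2k\theta\big), & n=2k,\ \forall k\in\mathbb{Z}.\end{cases}$$ (iv) If $a=a_0+a_1\mathbf{e}_1+a_2\mathbf{e}_2+a_3\mathbf{e}_3\in S_4$, then $$a^n=(2\Re(a))^{n-1}a\quad\text{for all } n\in\mathbb{N}.$$ (v) If $a=a_0+a_1\mathbf{e}_1+a_2\mathbf{e}_2+a_3\mathbf{e}_3\in S_5\cap S_4=E_0$, then $$a^n=\Im(a)^n=0\quad\text{for all } n\ge 2;$$ and if $a=a_0+a_1\mathbf{e}_1+a_2\mathbf{e}_2+a_3\mathbf{e}_3\in S_5\setminus S_4$, then $$a^n=(\Re(a))^n+n(\Re(a))^{n-1}\Im(a)\quad\text{for all } n\in\mathbb{Z}.$$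
   Context: $C\ell_2=C\ell_{2,0}$ is the associative unital real algebra with $\mathbb{R}$-basis $\mathbf{e}_0=1,\mathbf{e}_1,\mathbf{e}_2,\mathbf{e}_3$ and multiplication rules $\mathbf{e}_1^2=\mathbf{e}_2^2=1$, $\mathbf{e}_3^2=-1$, $\mathbf{e}_1\mathbf{e}_2=\mathbf{e}_3=-\mathbf{e}_2\mathbf{e}_1$, $\mathbf{e}_2\mathbf{e}_3=-\mathbf{e}_1=-\mathbf{e}_3\mathbf{e}_2$, $\mathbf{e}_3\mathbf{e}_1=-\mathbf{e}_2=-\mathbf{e}_1\mathbf{e}_3$. For $a=a_0+a_1\mathbf{e}_1+a_2\mathbf{e}_2+a_3\mathbf{e}_3$ with $a_i\in\mathbb{R}$: conjugate $\overline{a}=a_0-a_1\mathbf{e}_1-a_2\mathbf{e}_2-a_3\mathbf{e}_3$, real part $\Re(a)=a_0$, imaginary part $\Im(a)=a_1\mathbf{e}_1+a_2\mathbf{e}_2+a_3\mathbf{e}_3$, $I_a=\overline{a}a=a\overline{a}=a_0^2-a_1^2-a_2^2+a_3^2$, $N_a=\sqrt{|I_a|}$, $V_a=a_1^2+a_2^2-a_3^2$. For $c\in\{1,0,-1\}$, $E_c=\{\epsilon_1\mathbf{e}_1+\epsilon_2\mathbf{e}_2+\epsilon_3\mathbf{e}_3:\epsilon_i\in\mathbb{R},\ \epsilon_1^2+\epsilon_2^2-\epsilon_3^2=c\}$. Set $S_1=\{a\in C\ell_2: I_a>0,\ V_a>0\}$, $S_2=\{a\in C\ell_2: I_a>0,\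 V_a<0\}$, $S_3=\{a\in C\ell_2: I_a<0,\ V_a>0\}$, $S_4=\{a\in C\ell_2: I_a=0\}$, $S_5=\{a\in C\ell_2: V_a=0\}$. If $I_a\ne0$ then $a$ is invertible with $a^{-1}=\overline{a}/I_a$, and negative powers are powers of $a^{-1}$. $\mathbb{N}$ denotes the positive integers, and $0^0=1$.
   Formalization: In (i), the existence of θ and the formula for a^n are claimed only for a_0 > 0, since cosh θ = a_0/N_a has no real solution when a_0 < 0 (e.g. a = -2 + e_1 in S_1); the other claims of (i) are stated on all of S_1. *)

theory Defs
  imports Complex_Main
begin

datatype cl2 = Cl2 (coord0: real) (coord1: real) (coord2: real) (coord3: real)

lemma cl2_eq_iff:
  "a = b \<longleftrightarrow> coord0 a = coord0 b \<and> coord1 a = coord1 b \<and> coord2 a = coord2 b \<and> coord3 a = coord3 b"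
  by (cases a; cases b) simp

instantiation cl2 :: real_algebra_1
begin

definition zero_cl2 :: cl2 where "0 = Cl2 0 0 0 0"

definition one_cl2 :: cl2 where "1 = Cl2 1 0 0 0"

definition plus_cl2 :: "cl2 \<Rightarrow> cl2 \<Rightarrow> cl2" where
  "a + b = Cl2 (coord0 a + coord0 b) (coord1 a + coord1 b) (coord2 a + coord2 b) (coord3 a + coord3 b)"

definition minus_cl2 :: "cl2 \<Rightarrow> cl2 \<Rightarrow> cl2" where
  "a - b = Cl2 (coord0 a - coord0 b) (coord1 a - coord1 b) (coord2 a - coord2 b) (coord3 a - coord3 b)"

definition uminus_cl2 :: "cl2 \<Rightarrow> cl2" where
  "- a = Cl2 (- coord0 a) (- coord1 a) (- coord2 a) (- coord3 a)"

definition scaleR_cl2 :: "real \<Rightarrow> cl2 \<Rightarrow> cl2" where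
  "r *\<^sub>R a = Cl2 (r * coord0 a) (r * coord1 a) (r * coord2 a) (r * coord3 a)"

text \<open>Bilinear extension of the multiplication table verified in \<open>cl2_mult_table\<close> below.\<close>

definition times_cl2 :: "cl2 \<Rightarrow> cl2 \<Rightarrow> cl2" where
  "a * b = Cl2
     (coord0 a * coord0 b + coord1 a * coord1 b + coord2 a * coord2 b - coord3 a * coord3 b)
     (coord0 a * coord1 b + coord1 a * coord0 b - coord2 a * coord3 b + coord3 a * coord2 b)
     (coord0 a * coord2 b + coord2 a * coord0 b - coord3 a * coord1 b + coord1 a * coord3 b)
     (coord0 a * coord3 b + coord3 a * coord0 b + coord1 a * coord2 b - coord2 a * coord1 b)"

instance
  by standard
    (simp_all add: cl2_eq_iff zero_cl2_def one_cl2_def plus_cl2_def minus_cl2_def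
      uminus_cl2_def scaleR_cl2_def times_cl2_def algebra_simps)

end

lemmas cl2_ops_defs =
  zero_cl2_def one_cl2_def plus_cl2_def minus_cl2_def uminus_cl2_def scaleR_cl2_def times_cl2_def

definition e1 :: cl2 where "e1 = Cl2 0 1 0 0"
definition e2 :: cl2 where "e2 = Cl2 0 0 1 0"
definition e3 :: cl2 where "e3 = Cl2 0 0 0 1"

lemma cl2_mult_table:
  "e1 * e1 = 1" "e2 * e2 = 1" "e3 * e3 = - 1"
  "e1 * e2 = e3" "e2 * e1 = - e3"
  "e2 * e3 = - e1" "e3 * e2 = e1"
  "e3 * e1 = - e2" "e1 * e3 = e2"
  by (simp_all add: cl2_eq_iff cl2_ops_defs e1_def e2_def e3_def)

lemma cl2_basis_expansion:
  "a = of_real (coord0 a) + coord1 a *\<^sub>R e1 + coord2 a *\<^sub>R e2 + coord3 a *\<^sub>R e3"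
  by (simp add: cl2_eq_iff of_real_def cl2_ops_defs e1_def e2_def e3_def)

definition cl_conj :: "cl2 \<Rightarrow> cl2" where
  "cl_conj a = of_real (coord0 a) - coord1 a *\<^sub>R e1 - coord2 a *\<^sub>R e2 - coord3 a *\<^sub>R e3"

definition cl_Re :: "cl2 \<Rightarrow> real" where
  "cl_Re a = coord0 a"

definition cl_Im :: "cl2 \<Rightarrow> cl2" where
  "cl_Im a = coord1 a *\<^sub>R e1 + coord2 a *\<^sub>R e2 + coord3 a *\<^sub>R e3"

definition cl_I :: "cl2 \<Rightarrow> real" where
  "cl_I a = (coord0 a)\<^sup>2 - (coord1 a)\<^sup>2 - (coord2 a)\<^sup>2 + (coord3 a)\<^sup>2"

definition cl_N :: "cl2 \<Rightarrow> real" where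
  "cl_N a = sqrt \<bar>cl_I a\<bar>"

definition cl_V :: "cl2 \<Rightarrow> real" where
  "cl_V a = (coord1 a)\<^sup>2 + (coord2 a)\<^sup>2 - (coord3 a)\<^sup>2"

lemma cl_conj_mult: "cl_conj a * a = of_real (cl_I a)" "a * cl_conj a = of_real (cl_I a)"
  by (simp_all add: cl2_eq_iff of_real_def cl2_ops_defs e1_def e2_def e3_def cl_conj_def cl_I_def
      power2_eq_square)

text \<open>
  With this instance the library's \<open>a powi n\<close> is \<open>a ^ n\<close> for \<open>n \<ge> 0\<close> and a power of \<open>inverse a\<close>
  for \<open>n < 0\<close>. The value of \<open>inverse a\<close> is meaningful only for \<open>cl_I a \<noteq> 0\<close>; otherwise it is 0.
\<close>

instantiation cl2 :: inverse
begin

definition inverse_cl2 :: "cl2 \<Rightarrow> cl2" where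
  "inverse a = cl_conj a /\<^sub>R cl_I a"

definition divide_cl2 :: "cl2 \<Rightarrow> cl2 \<Rightarrow> cl2" where
  "divide_cl2 a b = a * inverse b"

instance ..

end

lemma cl2_inverse:
  assumes "cl_I a \<noteq> 0"
  shows "inverse a * a = 1" "a * inverse a = 1"
  using assms by (simp_all add: inverse_cl2_def cl_conj_mult, simp_all add: of_real_def)

definition cl_E :: "real \<Rightarrow> cl2 set" where
  "cl_E c = {x *\<^sub>R e1 + y *\<^sub>R e2 + z *\<^sub>R e3 | x y z. x\<^sup>2 + y\<^sup>2 - z\<^sup>2 = c}"

text \<open>
  \<open>cl_S1\<close> also contains elements with negative real part, such as \<open>-2 + e1\<close>. Since \<open>cosh\<close> is
  positive on the reals, \<open>cosh \<theta> = cl_Re a / cl_N a\<close> is solvable only when \<open>cl_Re a > 0\<close>;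
  an element with \<open>cl_Re a < 0\<close> is the negative of one with positive real part.
\<close>

definition cl_S1 :: "cl2 set" where "cl_S1 = {a. cl_I a > 0 \<and> cl_V a > 0}"
definition cl_S2 :: "cl2 set" where "cl_S2 = {a. cl_I a > 0 \<and> cl_V a < 0}"
definition cl_S3 :: "cl2 set" where "cl_S3 = {a. cl_I a < 0 \<and> cl_V a > 0}"
definition cl_S4 :: "cl2 set" where "cl_S4 = {a. cl_I a = 0}"
definition cl_S5 :: "cl2 set" where "cl_S5 = {a. cl_V a = 0}"

end

theory Submission
  imports Defs
begin

text \<open>
  Every \<open>\<epsilon> \<in> cl_E c\<close> squares to the scalar \<open>c\<close>, so \<open>1\<close> and \<open>\<epsilon> \<noteq> 0\<close> span a commutative subalgebra:
  the split-complex, complex or dual numbers for \<open>c = 1, -1, 0\<close>. The polar form of \<open>a\<close> lives in the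
  subalgebra spanned by \<open>1\<close> and \<open>cl_Im a\<close>, where the power formulas are the addition theorems of
  \<open>cosh, sinh\<close> and \<open>cos, sin\<close>. When \<open>cl_I a = 0\<close>, the quadratic equation
  \<open>a\<^sup>2 = 2 Re(a) a - I\<^sub>a\<close> reduces to \<open>a\<^sup>2 = 2 Re(a) a\<close>.
\<close>

section \<open>Real and imaginary parts, and normalization\<close>

lemma cl2_Re_Im: "a = of_real (cl_Re a) + cl_Im a"
  by (simp add: cl2_eq_iff cl_Re_def cl_Im_def of_real_def cl2_ops_defs e1_def e2_def e3_def)

lemma cl_E_square: "\<epsilon> * \<epsilon> = of_real c" if "\<epsilon> \<in> cl_E c"
  using that by (auto simp: cl_E_def cl2_eq_iff of_real_def cl2_ops_defs e1_def e2_def e3_def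
      power2_eq_square)

lemma cl_I_eq: "cl_I a = (cl_Re a)\<^sup>2 - cl_V a"
  by (simp add: cl_I_def cl_Re_def cl_V_def)

lemma cl_N_square: "(cl_N a)\<^sup>2 = \<bar>cl_I a\<bar>"
  by (simp add: cl_N_def)

lemma cl_N_pos: "cl_N a > 0" if "cl_I a \<noteq> 0"
  using that by (simp add: cl_N_def)

lemma cl_Im_in_cl_E: "cl_Im a \<in> cl_E (cl_V a)"
  unfolding cl_E_def cl_Im_def cl_V_def by blast

lemma scaleR_in_cl_E:
  assumes "\<epsilon> \<in> cl_E c"
  shows "r *\<^sub>R \<epsilon> \<in> cl_E (r\<^sup>2 * c)"
proof -
  obtain x y z where \<epsilon>: "\<epsilon> = x *\<^sub>R e1 + y *\<^sub>R e2 + z *\<^sub>R e3" and c: "x\<^sup>2 + y\<^sup>2 - z\<^sup>2 = c"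
    using assms unfolding cl_E_def by blast
  have "r *\<^sub>R \<epsilon> = (r * x) *\<^sub>R e1 + (r * y) *\<^sub>R e2 + (r * z) *\<^sub>R e3"
    by (simp add: \<epsilon> scaleR_add_right)
  moreover have "(r * x)\<^sup>2 + (r * y)\<^sup>2 - (r * z)\<^sup>2 = r\<^sup>2 * c"
    by (simp add: c[symmetric] algebra_simps power_mult_distrib)
  ultimately show ?thesis
    unfolding cl_E_def by blast
qed

text \<open>Dividing by \<open>v\<close> divides the quadratic form \<open>cl_V\<close> by the
  square of \<open>v\<close>. It is applied with \<open>v = sqrt (cl_V a)\<close> for
  \<open>c = 1\<close> and \<open>v = sqrt (- cl_V a)\<close> for \<open>c = -1\<close>.\<close>

lemma cl_Im_normalized_in_cl_E: "cl_Im a /\<^sub>R v \<in> cl_E c" if "cl_V a = c * v\<^sup>2" "v \<noteq> 0"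
  using scaleR_in_cl_E[OF cl_Im_in_cl_E, of "inverse v" a] that
  by (simp add: power_inverse field_simps)

text \<open>The factors \<open>r\<close> and \<open>v\<close> merely cancel. Leaving them free
  covers the hyperbolic and circular forms, where \<open>r = cl_N a\<close>, and the dual-number
  form, where \<open>r = cl_Re a\<close> and \<open>v = 1\<close>.\<close>

lemma cl2_normalized:
  assumes "r \<noteq> 0" "v \<noteq> 0"
  shows "a = r *\<^sub>R (of_real (cl_Re a / r) + (cl_Im a /\<^sub>R v) * of_real (v / r))"
proof -
  have "r *\<^sub>R (of_real (cl_Re a / r) + (cl_Im a /\<^sub>R v) * of_real (v / r)) = of_real (cl_Re a) + cl_Im a"
    using assms by (simp add: of_real_def scaleR_add_right)
  then show ?thesis
    using cl2_Re_Im by simp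
qed

section \<open>Integer powers from a recurrence\<close>

lemma cl_E_mult:
  assumes "\<epsilon> \<in> cl_E c"
  shows "(of_real p + \<epsilon> * of_real q) * (of_real r + \<epsilon> * of_real s) =
    of_real (p * r + c * q * s) + \<epsilon> * of_real (p * s + q * r)"
proof -
  have "(of_real p + \<epsilon> * of_real q) * (of_real r + \<epsilon> * of_real s) =
    (p * r) *\<^sub>R 1 + (q * s) *\<^sub>R (\<epsilon> * \<epsilon>) + (p * s + q * r) *\<^sub>R \<epsilon>"
    by (simp add: of_real_def algebra_simps)
  then show ?thesis
    by (simp add: cl_E_square[OF assms] of_real_def algebra_simps)
qed

text \<open>Multiplication by an invertible \<open>a\<close> is a bijection, so the one-step
  recurrence fixes \<open>f\<close> in both directions from \<open>f 0\<close>. This treats negative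
  exponents without division ring laws, which fail here because of zero divisors.\<close>

lemma cl2_powi_unique:
  fixes f :: "int \<Rightarrow> cl2"
  assumes "cl_I a \<noteq> 0" and zero: "f 0 = 1" and step: "\<And>n. f (n + 1) = a * f n"
  shows "a powi n = f n"
proof -
  have pos: "f (int m) = a ^ m" for m
  proof (induction m)
    case (Suc m)
    then show ?case
      using step[of "int m"] by (simp add: add.commute)
  qed (simp add: zero)
  have neg: "f (- int m) = inverse a ^ m" for m
  proof (induction m)
    case (Suc m)
    \<comment> \<open>The recurrence at index \<open>- (m + 1)\<close> expresses
      \<open>f (- m)\<close> as \<open>a * f (- (m + 1))\<close>; the inverse then cancels
      \<open>a\<close>.\<close>
    have "inverse a * f (- int m) = inverse a * a * f (- int (Suc m))"
      using step[of "- int (Suc m)"] by (simp add: mult.assoc)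
    then show ?case
      using Suc cl2_inverse(1)[OF assms(1)] by simp
  qed (simp add: zero)
  show ?thesis
    using pos[of "nat n"] neg[of "nat (- n)"] by (cases "n \<ge> 0") (simp_all add: power_int_def)
qed

text \<open>The recurrences for \<open>p\<close> and \<open>q\<close> are the coefficients of
  \<open>1\<close> and \<open>\<epsilon>\<close> in
  \<open>(x + \<epsilon> y) (p n + \<epsilon> q n)\<close>, with \<open>c\<close> entering through
  the square of \<open>\<epsilon>\<close>. The values at 0 encode the unit.\<close>

lemma cl2_powi_polar:
  fixes p q :: "int \<Rightarrow> real"
  assumes "cl_I a \<noteq> 0" "\<epsilon> \<in> cl_E c" "r \<noteq> 0"
    and a: "a = r *\<^sub>R (of_real x + \<epsilon> * of_real y)"
    and "p 0 = 1" "q 0 = 0"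
    and p: "\<And>n. p (n + 1) = x * p n + c * y * q n"
    and q: "\<And>n. q (n + 1) = x * q n + y * p n"
  shows "a powi n = (r powi n) *\<^sub>R (of_real (p n) + \<epsilon> * of_real (q n))"
proof (rule cl2_powi_unique[OF \<open>cl_I a \<noteq> 0\<close>])
  show "(r powi (n + 1)) *\<^sub>R (of_real (p (n + 1)) + \<epsilon> * of_real (q (n + 1))) =
    a * ((r powi n) *\<^sub>R (of_real (p n) + \<epsilon> * of_real (q n)))" for n
    unfolding p q a cl_E_mult[OF \<open>\<epsilon> \<in> cl_E c\<close>, symmetric]
    using \<open>r \<noteq> 0\<close> by (simp add: power_int_add_1 del: of_real_add of_real_mult)
qed (use assms in simp)

text \<open>The characteristic equation of \<open>a\<close>, with trace \<open>2 * cl_Re a\<close>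
  and norm \<open>cl_I a\<close>.\<close>

lemma cl2_square: "a * a = (2 * cl_Re a) *\<^sub>R a - of_real (cl_I a)"
  by (simp add: cl2_eq_iff cl_Re_def cl_I_def of_real_def cl2_ops_defs power2_eq_square)

section \<open>Existence of the angle\<close>

lemma cl_S1_angle:
  assumes "a \<in> cl_S1" "cl_Re a > 0"
  obtains \<theta> where "cosh \<theta> = cl_Re a / cl_N a" "sinh \<theta> = sqrt (cl_V a) / cl_N a"
proof -
  define \<theta> where "\<theta> = arsinh (sqrt (cl_V a) / cl_N a)"
  have pos: "cl_I a > 0" "cl_V a > 0" "cl_N a > 0"
    using assms cl_N_pos[of a] by (auto simp: cl_S1_def)
  have s: "sinh \<theta> = sqrt (cl_V a) / cl_N a"
    by (simp add: \<theta>_def sinh_arsinh_real)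
  \<comment> \<open>With \<open>sinh \<theta>\<close> prescribed,
    \<open>cosh^2 = 1 + sinh^2\<close>; here \<open>N^2 = I = Re^2 - V\<close>, so the numerator
    \<open>N^2 + V\<close> is \<open>Re^2\<close>.\<close>
  have "(cosh \<theta>)\<^sup>2 = ((cl_N a)\<^sup>2 + cl_V a) / (cl_N a)\<^sup>2"
    using pos by (simp add: cosh_square_eq s power_divide field_simps)
  also have "\<dots> = (cl_Re a / cl_N a)\<^sup>2"
    using pos by (simp add: cl_N_square cl_I_eq power_divide)
  \<comment> \<open>Positivity of \<open>cl_Re a\<close> selects the positive square root.\<close>
  finally have "cosh \<theta> = cl_Re a / cl_N a"
    using assms pos by (simp add: power2_eq_iff_nonneg)
  with s show thesis
    by (rule that[rotated])
qed

text \<open>The two quotients are coordinates of a point on the unit circle, because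
  \<open>N^2 = I = Re^2 - V\<close>. Every such point has an angle, so the sign of
  \<open>cl_Re a\<close> is free.\<close>

lemma cl_S2_angle:
  assumes "a \<in> cl_S2"
  obtains \<theta> where "cos \<theta> = cl_Re a / cl_N a" "sin \<theta> = sqrt (- cl_V a) / cl_N a"
proof -
  have pos: "cl_I a > 0" "cl_V a < 0" "cl_N a > 0"
    using assms cl_N_pos[of a] by (auto simp: cl_S2_def)
  have "(cl_Re a / cl_N a)\<^sup>2 + (sqrt (- cl_V a) / cl_N a)\<^sup>2 = ((cl_Re a)\<^sup>2 - cl_V a) / (cl_N a)\<^sup>2"
    using pos by (simp add: power_divide field_simps)
  also have "\<dots> = 1"
    using pos by (simp add: cl_N_square flip: cl_I_eq)
  finally show thesis
    using sincos_total_2pi that by metis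
qed

text \<open>Now \<open>N^2 = - I = V - Re^2\<close>, which exchanges \<open>sinh\<close> and
  \<open>cosh\<close>. The quotient matched with \<open>cosh\<close> is a positive square root, and
  \<open>sinh\<close> attains every real value, so again the sign of \<open>cl_Re a\<close> is
  free.\<close>

lemma cl_S3_angle:
  assumes "a \<in> cl_S3"
  obtains \<theta> where "sinh \<theta> = cl_Re a / cl_N a" "cosh \<theta> = sqrt (cl_V a) / cl_N a"
proof -
  define \<theta> where "\<theta> = arsinh (cl_Re a / cl_N a)"
  have pos: "cl_I a < 0" "cl_V a > 0" "cl_N a > 0"
    using assms cl_N_pos[of a] by (auto simp: cl_S3_def)
  have s: "sinh \<theta> = cl_Re a / cl_N a"
    by (simp add: \<theta>_def sinh_arsinh_real)
  have "(cosh \<theta>)\<^sup>2 = ((cl_N a)\<^sup>2 + (cl_Re a)\<^sup>2) / (cl_N a)\<^sup>2"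
    using pos by (simp add: cosh_square_eq s power_divide field_simps)
  also have "\<dots> = (sqrt (cl_V a) / cl_N a)\<^sup>2"
    using pos by (simp add: cl_N_square cl_I_eq power_divide)
  finally have "cosh \<theta> = sqrt (cl_V a) / cl_N a"
    using pos by (simp add: power2_eq_iff_nonneg)
  with s show thesis
    by (rule that)
qed

section \<open>Addition theorems as power formulas\<close>

lemma cl2_powi_cosh_sinh:
  assumes "cl_I a \<noteq> 0" "\<epsilon> \<in> cl_E 1" "r \<noteq> 0"
    and "a = r *\<^sub>R (of_real (cosh \<theta>) + \<epsilon> * of_real (sinh \<theta>))"
  shows "a powi n = (r powi n) *\<^sub>R
    (of_real (cosh (of_int n * \<theta>)) + \<epsilon> * of_real (sinh (of_int n * \<theta>)))"
  by (rule cl2_powi_polar[OF assms])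
    (simp_all add: cosh_add sinh_add algebra_simps)

lemma cl2_powi_cos_sin:
  assumes "cl_I a \<noteq> 0" "\<epsilon> \<in> cl_E (- 1)" "r \<noteq> 0"
    and "a = r *\<^sub>R (of_real (cos \<theta>) + \<epsilon> * of_real (sin \<theta>))"
  shows "a powi n = (r powi n) *\<^sub>R
    (of_real (cos (of_int n * \<theta>)) + \<epsilon> * of_real (sin (of_int n * \<theta>)))"
  by (rule cl2_powi_polar[OF assms])
    (simp_all add: cos_add sin_add algebra_simps)

text \<open>Since \<open>\<epsilon>\<close> squares to 1,
  \<open>sinh \<theta> + \<epsilon> cosh \<theta>\<close> equals
  \<open>\<epsilon> (cosh \<theta> + \<epsilon> sinh \<theta>)\<close>. Its nth power keeps a factor
  \<open>\<epsilon>\<close> exactly for odd \<open>n\<close>, hence the case split in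
  \<open>p\<close> and \<open>q\<close>.\<close>

lemma cl2_powi_sinh_cosh:
  fixes \<theta> :: real
  defines "p \<equiv> \<lambda>n::int. if even n then cosh (of_int n * \<theta>) else sinh (of_int n * \<theta>)"
    and "q \<equiv> \<lambda>n::int. if even n then sinh (of_int n * \<theta>) else cosh (of_int n * \<theta>)"
  assumes "cl_I a \<noteq> 0" "\<epsilon> \<in> cl_E 1" "r \<noteq> 0"
    and "a = r *\<^sub>R (of_real (sinh \<theta>) + \<epsilon> * of_real (cosh \<theta>))"
  shows "a powi n = (r powi n) *\<^sub>R (of_real (p n) + \<epsilon> * of_real (q n))"
  by (rule cl2_powi_polar[OF assms(3-)])
    (simp_all add: p_def q_def cosh_add sinh_add algebra_simps)

section \<open>Elements with vanishing \<open>cl_I\<close> or \<open>cl_V\<close>\<close>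

lemma cl_S4_power:
  assumes "a \<in> cl_S4" "n \<ge> 1"
  shows "a ^ n = ((2 * cl_Re a) ^ (n - 1)) *\<^sub>R a"
  using assms(2)
\<comment> \<open>Starting at 1 avoids truncation in \<open>n - 1\<close>; the base case relies on
  \<open>0 ^ 0 = 1\<close> when \<open>cl_Re a = 0\<close>.\<close>
proof (induction n rule: nat_induct_at_least)
  case (Suc n)
  have "a * a = (2 * cl_Re a) *\<^sub>R a"
    using cl2_square[of a] assms(1) by (simp add: cl_S4_def)
  with Suc show ?case
    by (cases n) (simp_all add: mult_ac)
qed simp

lemma cl_S5_Int_cl_S4: "cl_S5 \<inter> cl_S4 = {a. cl_Re a = 0 \<and> cl_V a = 0}"
  by (auto simp: cl_S5_def cl_S4_def cl_I_eq)

lemma cl_S5_Int_cl_S4_eq: "cl_S5 \<inter> cl_S4 = cl_E 0"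
proof (intro equalityI subsetI)
  fix a assume "a \<in> cl_S5 \<inter> cl_S4"
  then show "a \<in> cl_E 0"
    using cl2_Re_Im[of a] cl_Im_in_cl_E[of a] by (simp add: cl_S5_Int_cl_S4)
next
  fix a assume "a \<in> cl_E 0"
  then show "a \<in> cl_S5 \<inter> cl_S4"
    by (auto simp: cl_S5_Int_cl_S4 cl_E_def cl_Re_def cl_V_def cl2_ops_defs e1_def e2_def e3_def)
qed

lemma cl_E0_Im: "cl_Im a = a" if "a \<in> cl_S5 \<inter> cl_S4"
  using cl2_Re_Im[of a] that by (simp add: cl_S5_Int_cl_S4)

lemma cl_E0_power: "a ^ n = 0" if "a \<in> cl_S5 \<inter> cl_S4" "n \<ge> 2"
proof -
  have "cl_Re a = 0"
    using that(1) by (simp only: cl_S5_Int_cl_S4 mem_Collect_eq)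
  \<comment> \<open>For \<open>n \<ge> 2\<close> the exponent \<open>n - 1\<close> is positive, so
    the scalar factor is a positive power of 0.\<close>
  then show ?thesis
    using cl_S4_power[of a n] that by simp
qed

text \<open>Here \<open>cl_Im a\<close> squares to 0, so the binomial expansion stops after its
  linear term.\<close>

lemma cl_S5_powi:
  assumes "a \<in> cl_S5 - cl_S4"
  shows "a powi n = of_real (cl_Re a powi n) + (of_int n * cl_Re a powi (n - 1)) *\<^sub>R cl_Im a"
proof -
  have "cl_V a = 0" and I: "cl_I a \<noteq> 0" and nz: "cl_Re a \<noteq> 0"
    using assms by (auto simp: cl_S5_def cl_S4_def cl_I_eq)
  then have E: "cl_Im a \<in> cl_E 0"
    using cl_Im_in_cl_E[of a] by simp
  have a: "a = cl_Re a *\<^sub>R (of_real 1 + cl_Im a * of_real (1 / cl_Re a))"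
    using cl2_normalized[OF nz, of 1 a] nz by simp
  \<comment> \<open>The recurrence with \<open>c = 0\<close> is solved by \<open>p n = 1\<close> and
    \<open>q n = n / cl_Re a\<close>: the first is constant and the second grows by
    \<open>1 / cl_Re a\<close> per step.\<close>
  have "a powi n = (cl_Re a powi n) *\<^sub>R (of_real 1 + cl_Im a * of_real (of_int n / cl_Re a))"
    by (rule cl2_powi_polar[OF I E nz a]) (simp_all add: add_divide_distrib)
  then show ?thesis
    using nz by (simp add: of_real_def scaleR_add_right power_int_diff)
qed

section \<open>Polar forms on the three open regions, and assembly\<close>

lemma cl_S1_polar:
  assumes "a \<in> cl_S1"
  shows "let \<epsilon> = cl_Im a /\<^sub>R sqrt (cl_V a) in
        a = of_real (cl_Re a) + cl_Im a \<and>
        a = cl_N a *\<^sub>R (of_real (cl_Re a / cl_N a) + \<epsilon> * of_real (sqrt (cl_V a) / cl_N a)) \<and>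
        \<epsilon> \<in> cl_E 1 \<and>
        (cl_Re a > 0 \<longrightarrow>
          (\<exists>\<theta>::real.
             cosh \<theta> = cl_Re a / cl_N a \<and>
             sinh \<theta> = sqrt (cl_V a) / cl_N a \<and>
             a = cl_N a *\<^sub>R (of_real (cosh \<theta>) + \<epsilon> * of_real (sinh \<theta>)) \<and>
             (\<forall>n::int. a powi n =
                (cl_N a powi n) *\<^sub>R
                  (of_real (cosh (of_int n * \<theta>)) + \<epsilon> * of_real (sinh (of_int n * \<theta>))))))"
    (is "let \<epsilon> = _ in _ \<and> _ \<and> _ \<and> (_ \<longrightarrow> ?ex \<epsilon>)")
proof -
  define \<epsilon> where "\<epsilon> = cl_Im a /\<^sub>R sqrt (cl_V a)"
  have I: "cl_I a \<noteq> 0" and N: "cl_N a \<noteq> 0" and V: "sqrt (cl_V a) \<noteq> 0"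
    using assms cl_N_pos[of a] by (auto simp: cl_S1_def)
  have E: "\<epsilon> \<in> cl_E 1"
    unfolding \<epsilon>_def using assms by (intro cl_Im_normalized_in_cl_E) (auto simp: cl_S1_def)
  note norm = cl2_normalized[OF N V, of a, folded \<epsilon>_def]
  have "?ex \<epsilon>" if Re: "cl_Re a > 0"
  proof -
    obtain \<theta> where \<theta>: "cosh \<theta> = cl_Re a / cl_N a" "sinh \<theta> = sqrt (cl_V a) / cl_N a"
      using cl_S1_angle[OF assms Re] .
    \<comment> \<open>Folding replaces the two quotients by the functions of
      \<open>\<theta>\<close>, turning the normalized form into the polar form.\<close>
    note polar = norm[folded \<theta>]
    show ?thesis
      using \<theta> polar cl2_powi_cosh_sinh[OF I E N polar] by blast
  qed
  with E norm show ?thesis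
    unfolding Let_def \<epsilon>_def[symmetric] using cl2_Re_Im by blast
qed

lemma cl_S2_polar:
  assumes "a \<in> cl_S2"
  shows "let \<epsilon> = cl_Im a /\<^sub>R sqrt (- cl_V a) in
        a = of_real (cl_Re a) + cl_Im a \<and>
        a = cl_N a *\<^sub>R (of_real (cl_Re a / cl_N a) + \<epsilon> * of_real (sqrt (- cl_V a) / cl_N a)) \<and>
        \<epsilon> \<in> cl_E (- 1) \<and>
        (\<exists>\<theta>::real.
           cos \<theta> = cl_Re a / cl_N a \<and>
           sin \<theta> = sqrt (- cl_V a) / cl_N a \<and>
           a = cl_N a *\<^sub>R (of_real (cos \<theta>) + \<epsilon> * of_real (sin \<theta>)) \<and>
           (\<forall>n::int. a powi n =
              (cl_N a powi n) *\<^sub>R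
                (of_real (cos (of_int n * \<theta>)) + \<epsilon> * of_real (sin (of_int n * \<theta>)))))"
    (is "let \<epsilon> = _ in _ \<and> _ \<and> _ \<and> (?ex \<epsilon>)")
proof -
  define \<epsilon> where "\<epsilon> = cl_Im a /\<^sub>R sqrt (- cl_V a)"
  have I: "cl_I a \<noteq> 0" and N: "cl_N a \<noteq> 0" and V: "sqrt (- cl_V a) \<noteq> 0"
    using assms cl_N_pos[of a] by (auto simp: cl_S2_def)
  have E: "\<epsilon> \<in> cl_E (- 1)"
    unfolding \<epsilon>_def using assms by (intro cl_Im_normalized_in_cl_E) (auto simp: cl_S2_def)
  note norm = cl2_normalized[OF N V, of a, folded \<epsilon>_def]
  have "?ex \<epsilon>"
  proof -
    obtain \<theta> where \<theta>: "cos \<theta> = cl_Re a / cl_N a" "sin \<theta> = sqrt (- cl_V a) / cl_N a"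
      using cl_S2_angle[OF assms] .
    note polar = norm[folded \<theta>]
    show ?thesis
      using \<theta> polar cl2_powi_cos_sin[OF I E N polar] by blast
  qed
  with E norm show ?thesis
    unfolding Let_def \<epsilon>_def[symmetric] using cl2_Re_Im by blast
qed

lemma cl_S3_polar:
  assumes "a \<in> cl_S3"
  shows "let \<epsilon> = cl_Im a /\<^sub>R sqrt (cl_V a) in
        a = of_real (cl_Re a) + cl_Im a \<and>
        a = cl_N a *\<^sub>R (of_real (cl_Re a / cl_N a) + \<epsilon> * of_real (sqrt (cl_V a) / cl_N a)) \<and>
        \<epsilon> \<in> cl_E 1 \<and>
        (\<exists>\<theta>::real.
           sinh \<theta> = cl_Re a / cl_N a \<and>
           cosh \<theta> = sqrt (cl_V a) / cl_N a \<and>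
           a = cl_N a *\<^sub>R (of_real (sinh \<theta>) + \<epsilon> * of_real (cosh \<theta>)) \<and>
           (\<forall>k::int. a powi (2 * k + 1) =
              (cl_N a powi (2 * k + 1)) *\<^sub>R
                (of_real (sinh (of_int (2 * k + 1) * \<theta>)) + \<epsilon> * of_real (cosh (of_int (2 * k + 1) * \<theta>)))) \<and>
           (\<forall>k::int. a powi (2 * k) =
              (cl_N a powi (2 * k)) *\<^sub>R
                (of_real (cosh (of_int (2 * k) * \<theta>)) + \<epsilon> * of_real (sinh (of_int (2 * k) * \<theta>)))))"
    (is "let \<epsilon> = _ in _ \<and> _ \<and> _ \<and> (?ex \<epsilon>)")
proof -
  define \<epsilon> where "\<epsilon> = cl_Im a /\<^sub>R sqrt (cl_V a)"
  have I: "cl_I a \<noteq> 0" and N: "cl_N a \<noteq> 0" and V: "sqrt (cl_V a) \<noteq> 0"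
    using assms cl_N_pos[of a] by (auto simp: cl_S3_def)
  have E: "\<epsilon> \<in> cl_E 1"
    unfolding \<epsilon>_def using assms by (intro cl_Im_normalized_in_cl_E) (auto simp: cl_S3_def)
  note norm = cl2_normalized[OF N V, of a, folded \<epsilon>_def]
  have "?ex \<epsilon>"
  proof -
    obtain \<theta> where \<theta>: "sinh \<theta> = cl_Re a / cl_N a" "cosh \<theta> = sqrt (cl_V a) / cl_N a"
      using cl_S3_angle[OF assms] .
    note polar = norm[folded \<theta>]
    have "a powi (2 * k + 1) = (cl_N a powi (2 * k + 1)) *\<^sub>R
        (of_real (sinh (of_int (2 * k + 1) * \<theta>)) + \<epsilon> * of_real (cosh (of_int (2 * k + 1) * \<theta>)))"
      for k :: int
      using cl2_powi_sinh_cosh[OF I E N polar, of "2 * k + 1"] by simp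
    moreover have "a powi (2 * k) = (cl_N a powi (2 * k)) *\<^sub>R
        (of_real (cosh (of_int (2 * k) * \<theta>)) + \<epsilon> * of_real (sinh (of_int (2 * k) * \<theta>)))"
      for k :: int
      using cl2_powi_sinh_cosh[OF I E N polar, of "2 * k"] by simp
    ultimately show ?thesis
      using \<theta> polar by blast
  qed
  with E norm show ?thesis
    unfolding Let_def \<epsilon>_def[symmetric] using cl2_Re_Im by blast
qed

theorem theorem2p2:
  shows
    "(\<forall>a \<in> cl_S1. let \<epsilon> = cl_Im a /\<^sub>R sqrt (cl_V a) in
        a = of_real (cl_Re a) + cl_Im a \<and>
        a = cl_N a *\<^sub>R (of_real (cl_Re a / cl_N a) + \<epsilon> * of_real (sqrt (cl_V a) / cl_N a)) \<and>
        \<epsilon> \<in> cl_E 1 \<and>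
        (cl_Re a > 0 \<longrightarrow>
          (\<exists>\<theta>::real.
             cosh \<theta> = cl_Re a / cl_N a \<and>
             sinh \<theta> = sqrt (cl_V a) / cl_N a \<and>
             a = cl_N a *\<^sub>R (of_real (cosh \<theta>) + \<epsilon> * of_real (sinh \<theta>)) \<and>
             (\<forall>n::int. a powi n =
                (cl_N a powi n) *\<^sub>R
                  (of_real (cosh (of_int n * \<theta>)) + \<epsilon> * of_real (sinh (of_int n * \<theta>)))))))
   \<and> (\<forall>a \<in> cl_S2. let \<epsilon> = cl_Im a /\<^sub>R sqrt (- cl_V a) in
        a = of_real (cl_Re a) + cl_Im a \<and>
        a = cl_N a *\<^sub>R (of_real (cl_Re a / cl_N a) + \<epsilon> * of_real (sqrt (- cl_V a) / cl_N a)) \<and>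
        \<epsilon> \<in> cl_E (- 1) \<and>
        (\<exists>\<theta>::real.
           cos \<theta> = cl_Re a / cl_N a \<and>
           sin \<theta> = sqrt (- cl_V a) / cl_N a \<and>
           a = cl_N a *\<^sub>R (of_real (cos \<theta>) + \<epsilon> * of_real (sin \<theta>)) \<and>
           (\<forall>n::int. a powi n =
              (cl_N a powi n) *\<^sub>R
                (of_real (cos (of_int n * \<theta>)) + \<epsilon> * of_real (sin (of_int n * \<theta>))))))
   \<and> (\<forall>a \<in> cl_S3. let \<epsilon> = cl_Im a /\<^sub>R sqrt (cl_V a) in
        a = of_real (cl_Re a) + cl_Im a \<and>
        a = cl_N a *\<^sub>R (of_real (cl_Re a / cl_N a) + \<epsilon> * of_real (sqrt (cl_V a) / cl_N a)) \<and>
        \<epsilon> \<in> cl_E 1 \<and>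
        (\<exists>\<theta>::real.
           sinh \<theta> = cl_Re a / cl_N a \<and>
           cosh \<theta> = sqrt (cl_V a) / cl_N a \<and>
           a = cl_N a *\<^sub>R (of_real (sinh \<theta>) + \<epsilon> * of_real (cosh \<theta>)) \<and>
           (\<forall>k::int. a powi (2 * k + 1) =
              (cl_N a powi (2 * k + 1)) *\<^sub>R
                (of_real (sinh (of_int (2 * k + 1) * \<theta>)) + \<epsilon> * of_real (cosh (of_int (2 * k + 1) * \<theta>)))) \<and>
           (\<forall>k::int. a powi (2 * k) =
              (cl_N a powi (2 * k)) *\<^sub>R
                (of_real (cosh (of_int (2 * k) * \<theta>)) + \<epsilon> * of_real (sinh (of_int (2 * k) * \<theta>))))))
   \<and> (\<forall>a \<in> cl_S4. \<forall>n::nat. n \<ge> 1 \<longrightarrow> a ^ n = ((2 * cl_Re a) ^ (n - 1)) *\<^sub>R a)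
   \<and> cl_S5 \<inter> cl_S4 = cl_E 0
   \<and> (\<forall>a \<in> cl_S5 \<inter> cl_S4. \<forall>n::nat. n \<ge> 2 \<longrightarrow> a ^ n = cl_Im a ^ n \<and> cl_Im a ^ n = 0)
   \<and> (\<forall>a \<in> cl_S5 - cl_S4. \<forall>n::int. a powi n =
        of_real (cl_Re a powi n) + (of_int n * cl_Re a powi (n - 1)) *\<^sub>R cl_Im a)"
  \<comment> \<open>Removing \<open>Int_iff\<close> from the simplifier keeps membership in
    \<open>cl_S5 \<inter> cl_S4\<close> intact, as the premises of \<open>cl_E0_Im\<close> and
    \<open>cl_E0_power\<close> require.\<close>
  by (intro conjI ballI allI impI)
    ((rule cl_S1_polar cl_S2_polar cl_S3_polar cl_S4_power cl_S5_Int_cl_S4_eq cl_S5_powi; assumption) |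
      (simp add: cl_E0_Im cl_E0_power del: Int_iff; fail))+

end
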